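(* Among $n$ experts in a stream of length $T$, suppose the best expert makes $M$ mistakes. There exists a deterministic algorithm for the discrete prediction with experts problem that uses space $\widetilde{O}\left(\frac{nM}{RT}\right)$ and achieves regret $R$.
   Context: Discrete prediction with experts problem (streaming). There are $n$ experts and a stream of $T$ days. On each day, the algorithm receives the predictions of all $n$ experts (elements of a fixed finite set, e.g. $\{0,1\}$), outputs its own prediction, and then the correct outcome is revealed. A prediction costs $0$ if it equals the outcome and $1$ otherwise (a mistake). The best expert is the expert with the fewest total mistakes over the $T$ days. Regret is amortized over days: the algorithm achieves regret $R$ if its total number of mistakes exceeds that of the best expert by at most $RT$. The algorithm is given $n$, $T$, the target regret $R$, and an upper bound $M$ on the number of mistakes of the best expert. Space is the amount of memory used while processing the stream; $\widetilde{O}(\cdot)$ hides polylogarithmic factors.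
   Formalization: Assumes RT is at least a constant times max(1,M) log(n+1), or that some deterministic algorithm (of any space) achieves regret R, as otherwise the claim fails; the space bound nM/(RT) is read as max(1, n·max(1,M)/(RT)), since below one bit it is false. *)

theory Defs
  imports Complex_Main
begin

text \<open>
  The predictions of a day arrive one after the other, in a fixed order of the experts, so
  the memory is bounded after every single stream item, not only between days.  The step
  functions depend only on the memory contents and the current item: clocks, expert
  indices and intermediate votes have to be stored in memory.
\<close>

record 'x stream_alg =
  init_mem :: "bool list"
  read_prediction :: "bool list \<Rightarrow> 'x \<Rightarrow> bool list"
  predict :: "bool list \<Rightarrow> 'x"
  read_outcome :: "bool list \<Rightarrow> 'x \<Rightarrow> bool list"

definition uses_space :: "'x stream_alg \<Rightarrow> nat \<Rightarrow> bool" where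
  "uses_space A s \<longleftrightarrow> length (init_mem A) = s \<and>
     (\<forall>m x. length m = s \<longrightarrow>
        length (read_prediction A m x) = s \<and> length (read_outcome A m x) = s)"

text \<open>A day consists of the list of the experts' predictions and the correct outcome.\<close>

type_synonym 'x day = "'x list \<times> 'x"

definition expert_stream :: "nat \<Rightarrow> nat \<Rightarrow> 'x day list \<Rightarrow> bool" where
  "expert_stream n T days \<longleftrightarrow> length days = T \<and> (\<forall>d\<in>set days. length (fst d) = n)"

definition expert_mistakes :: "'x day list \<Rightarrow> nat \<Rightarrow> nat" where
  "expert_mistakes days i = card {t. t < length days \<and> fst (days ! t) ! i \<noteq> snd (days ! t)}"

definition best_mistakes :: "nat \<Rightarrow> 'x day list \<Rightarrow> nat" where
  "best_mistakes n days = Min (expert_mistakes days ` {..<n})"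

fun mistakes_from :: "'x stream_alg \<Rightarrow> bool list \<Rightarrow> 'x day list \<Rightarrow> nat" where
  "mistakes_from A m [] = 0"
| "mistakes_from A m ((ps, y) # days) =
     (let m' = foldl (read_prediction A) m ps
      in (if predict A m' = y then 0 else 1) + mistakes_from A (read_outcome A m' y) days)"

definition alg_mistakes :: "'x stream_alg \<Rightarrow> 'x day list \<Rightarrow> nat" where
  "alg_mistakes A days = mistakes_from A (init_mem A) days"

text \<open>
  \<open>M\<close> is an upper bound on the number of mistakes of the best expert; the regret is
  measured against the actual number of mistakes of that expert.
\<close>

definition achieves_regret ::
    "'x stream_alg \<Rightarrow> nat \<Rightarrow> nat \<Rightarrow> nat \<Rightarrow> real \<Rightarrow> bool" where
  "achieves_regret A n T M R \<longleftrightarrow>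
     (\<forall>days. expert_stream n T days \<and> best_mistakes n days \<le> M \<longrightarrow>
        real (alg_mistakes A days) \<le> real (best_mistakes n days) + R * real T)"

text \<open>
  The quantity \<open>n M / (R T)\<close>, with \<open>M\<close> and the whole expression bounded below by 1: without
  these bounds it vanishes for \<open>M = 0\<close> and drops below one bit, even after multiplication
  by logarithmic factors, for large \<open>T\<close>.
\<close>

definition space_bound :: "nat \<Rightarrow> nat \<Rightarrow> nat \<Rightarrow> real \<Rightarrow> real" where
  "space_bound n T M R = max 1 (real n * real (max 1 M) / (R * real T))"

end

theory Submission imports Defs "HOL-Library.Cardinality" begin

text \<open>
  When \<open>R T \<ge> K max 1 M ln (n + 1)\<close>, split the experts into blocks of \<open>k\<close> and run the halving
  algorithm on one block at a time; when all experts of the block have erred, pass cyclically to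
  the next block.  Each phase costs at most \<open>1 + log\<^sub>2 k\<close> mistakes, and the best expert errs in
  every completed phase of its own block, so at most \<open>(M + 1) \<lceil>n / k\<rceil>\<close> phases are started.
  Otherwise the bound allows about \<open>n\<close> bits times logarithms: enough to store the mistake counts
  of all experts, and a winning strategy of the prediction game needs to know only these counts,
  the algorithm's own count and the number of remaining days.
\<close>

section \<open>From day-level automata to stream algorithms\<close>

text \<open>Only the number of states matters: an injection of \<open>S\<close> into the bit strings
  of length \<open>s\<close> turns any finite automaton into a stream algorithm.\<close>

lemma stream_alg_of_automaton:
  fixes f g :: "'s \<Rightarrow> 'x \<Rightarrow> 's" and p :: "'s \<Rightarrow> 'x"
  assumes S: "finite S" "card S \<le> 2 ^ s" "s0 \<in> S"
    and f: "\<And>\<sigma> x. \<sigma> \<in> S \<Longrightarrow> f \<sigma> x \<in> S" and g: "\<And>\<sigma> x. \<sigma> \<in> S \<Longrightarrow> g \<sigma> x \<in> S"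
  obtains A enc where "uses_space A s" "init_mem A = enc s0"
    "\<And>\<sigma>. \<sigma> \<in> S \<Longrightarrow> predict A (enc \<sigma>) = p \<sigma>"
    "\<And>\<sigma> x. \<sigma> \<in> S \<Longrightarrow> read_prediction A (enc \<sigma>) x = enc (f \<sigma> x)"
    "\<And>\<sigma> x. \<sigma> \<in> S \<Longrightarrow> read_outcome A (enc \<sigma>) x = enc (g \<sigma> x)"
proof -
  let ?B = "{m :: bool list. length m = s}"
  have "finite ?B" "card ?B = 2 ^ s"
    using finite_lists_length_eq[of "UNIV :: bool set" s] card_lists_length_eq[of "UNIV :: bool set" s]
    by simp_all
  then obtain enc where enc: "enc ` S \<subseteq> ?B" "inj_on enc S"
    using card_le_inj[of S ?B] S by auto
  define dec where "dec = inv_into S enc"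
  have len: "length (enc \<sigma>) = s" if "\<sigma> \<in> S" for \<sigma>
    using that enc(1) by blast
  have dec: "dec (enc \<sigma>) = \<sigma>" if "\<sigma> \<in> S" for \<sigma>
    using that enc by (simp add: dec_def)
  \<comment> \<open>\<open>uses_space\<close> speaks about all bit strings of length
    \<open>s\<close>; those that encode no state are left unchanged.\<close>
  define A where "A = \<lparr>init_mem = enc s0,
    read_prediction = (\<lambda>m x. if m \<in> enc ` S then enc (f (dec m) x) else m),
    predict = (\<lambda>m. p (dec m)),
    read_outcome = (\<lambda>m x. if m \<in> enc ` S then enc (g (dec m) x) else m)\<rparr>"
  show ?thesis
  proof (rule that[of A enc])
    show "uses_space A s"
      using S(3) f g by (auto simp: uses_space_def A_def dec len)
    show "init_mem A = enc s0" by (simp add: A_def)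
  next
    fix \<sigma> x assume \<sigma>: "\<sigma> \<in> S"
    then show "predict A (enc \<sigma>) = p \<sigma>"
      "read_prediction A (enc \<sigma>) x = enc (f \<sigma> x)"
      "read_outcome A (enc \<sigma>) x = enc (g \<sigma> x)"
      by (simp_all add: A_def dec)
  qed
qed

text \<open>A machine with one transition per day. It sees only a window of the predictions, chosen
  by its state, so that a stream algorithm simulating it has to buffer at most \<open>k\<close> of
  them.\<close>

fun day_mistakes :: "('s \<Rightarrow> nat) \<Rightarrow> nat \<Rightarrow> ('s \<Rightarrow> 'x list \<Rightarrow> 'x) \<Rightarrow> ('s \<Rightarrow> 'x list \<Rightarrow> 'x \<Rightarrow> 's) \<Rightarrow>
    's \<Rightarrow> 'x day list \<Rightarrow> nat" where
  "day_mistakes w k P U \<sigma> [] = 0"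
| "day_mistakes w k P U \<sigma> ((ps, y) # days) =
     (let b = take k (drop (w \<sigma>) ps)
      in (if P \<sigma> b = y then 0 else 1) + day_mistakes w k P U (U \<sigma> b y) days)"

text \<open>Shorter lists can be padded to words of length \<open>k\<close> by one extra letter. The
  induction bounds the geometric sum in Horner form instead.\<close>

lemma card_lists_length_le_bound:
  "card {b :: 'x::finite list. length b \<le> k} \<le> (CARD('x) + 1) ^ k"
proof -
  have "(\<Sum>i\<le>k. CARD('x) ^ i) \<le> (CARD('x) + 1) ^ k"
  proof (induction k)
    case (Suc k)
    have "(\<Sum>i\<le>Suc k. CARD('x) ^ i) = 1 + CARD('x) * (\<Sum>i\<le>k. CARD('x) ^ i)"
      by (simp add: sum.atMost_Suc_shift sum_distrib_left del: sum.atMost_Suc)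
    also have "\<dots> \<le> (CARD('x) + 1) ^ k + CARD('x) * (CARD('x) + 1) ^ k"
      using Suc by (intro add_mono mult_left_mono) auto
    finally show ?case by simp
  qed simp
  then show ?thesis
    using card_lists_length_le[of "UNIV :: 'x set" k] by simp
qed

text \<open>During a day the memory holds the day-level state, the position in the list of
  predictions and the part of the window already read. The three factors in the assumption on
  \<open>s\<close> bound the numbers of their values.\<close>

lemma stream_alg_of_day_automaton:
  fixes P :: "'s \<Rightarrow> ('x::finite) list \<Rightarrow> 'x"
  assumes D: "finite D" "\<sigma>0 \<in> D" "\<And>\<sigma> b y. \<sigma> \<in> D \<Longrightarrow> U \<sigma> b y \<in> D"
    and s: "card D * (n + 1) * (CARD('x) + 1) ^ k \<le> 2 ^ s"
  obtains A where "uses_space A s"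
    "\<And>T days. expert_stream n T days \<Longrightarrow> alg_mistakes A days = day_mistakes w k P U \<sigma>0 days"
proof -
  define S where "S = D \<times> {..n} \<times> {b :: 'x list. length b \<le> k}"
  \<comment> \<open>The position stops at \<open>n\<close> and the buffer at length
    \<open>k\<close>, so \<open>S\<close> is closed under \<open>f\<close> even on days with too
    many predictions.\<close>
  define f where "f = (\<lambda>(\<sigma>, i, b) x.
    (\<sigma>, if i < n then Suc i else i, if w \<sigma> \<le> i \<and> length b < k then b @ [x] else b) :: 's \<times> nat \<times> 'x list)"
  define g where "g = (\<lambda>(\<sigma>, i::nat, b) y. (U \<sigma> b y, 0::nat, [] :: 'x list))"
  define p where "p = (\<lambda>(\<sigma>, i::nat, b). P \<sigma> b)"
  have finS: "finite S"
    using D(1) finite_lists_length_le[of "UNIV :: 'x set" k] by (auto simp: S_def)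
  have "card S \<le> card D * (n + 1) * (CARD('x) + 1) ^ k"
    using card_lists_length_le_bound[where ?'x = 'x and k = k]
    by (simp add: S_def card_cartesian_product mult.assoc del: mult_Suc mult_Suc_right)
  with s have cardS: "card S \<le> 2 ^ s" by linarith
  have s0: "(\<sigma>0, 0, []) \<in> S" using D by (simp add: S_def)
  have fS: "f \<sigma> x \<in> S" if "\<sigma> \<in> S" for \<sigma> x using that by (auto simp: S_def f_def)
  have gS: "g \<sigma> x \<in> S" if "\<sigma> \<in> S" for \<sigma> x using that D by (auto simp: S_def g_def)
  obtain A enc where A: "uses_space A s" "init_mem A = enc (\<sigma>0, 0, [])"
    "\<And>\<sigma>. \<sigma> \<in> S \<Longrightarrow> predict A (enc \<sigma>) = p \<sigma>"
    "\<And>\<sigma> x. \<sigma> \<in> S \<Longrightarrow> read_prediction A (enc \<sigma>) x = enc (f \<sigma> x)"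
    "\<And>\<sigma> x. \<sigma> \<in> S \<Longrightarrow> read_outcome A (enc \<sigma>) x = enc (g \<sigma> x)"
    using stream_alg_of_automaton[of S s "(\<sigma>0, 0, [])" f g p] finS cardS s0 fS gS by metis
  have read: "foldl (read_prediction A) (enc (\<sigma>, 0, [])) ps
      = enc (\<sigma>, length ps, take k (drop (w \<sigma>) ps))" if "\<sigma> \<in> D" "length ps \<le> n" for \<sigma> ps
    using that(2)
  proof (induction ps rule: rev_induct)
    case (snoc x ps)
    have "(\<sigma>, length ps, take k (drop (w \<sigma>) ps)) \<in> S"
      using that(1) snoc.prems by (simp add: S_def)
    \<comment> \<open>The item \<open>x\<close> has index \<open>length ps\<close>; it enters the
      buffer exactly if the window has begun and is not yet full.\<close>
    moreover have "f (\<sigma>, length ps, take k (drop (w \<sigma>) ps)) x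
        = (\<sigma>, length (ps @ [x]), take k (drop (w \<sigma>) (ps @ [x])))"
      using snoc.prems by (auto simp: f_def not_le not_less Cons_nth_drop_Suc take_Cons')
    ultimately show ?case using snoc A(4) by simp
  qed simp
  have "mistakes_from A (enc (\<sigma>, 0, [])) days = day_mistakes w k P U \<sigma> days"
    if "\<sigma> \<in> D" "\<forall>d\<in>set days. length (fst d) = n" for \<sigma> days
    using that
  proof (induction days arbitrary: \<sigma>)
    case (Cons d days)
    obtain ps y where d: "d = (ps, y)" by fastforce
    let ?\<tau> = "(\<sigma>, length ps, take k (drop (w \<sigma>) ps))"
    have "?\<tau> \<in> S" using Cons.prems d by (simp add: S_def)
    then have "predict A (enc ?\<tau>) = P \<sigma> (take k (drop (w \<sigma>) ps))"
      "read_outcome A (enc ?\<tau>) y = enc (U \<sigma> (take k (drop (w \<sigma>) ps)) y, 0, [])"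
      by (simp_all add: A p_def g_def)
    then show ?case
      using Cons d D(3) read[of \<sigma> ps] by (simp add: Let_def)
  qed simp
  then have "alg_mistakes A days = day_mistakes w k P U \<sigma>0 days"
    if "expert_stream n T days" for T days
    using that D(2) A(2) by (simp add: alg_mistakes_def expert_stream_def)
  with A(1) show ?thesis using that by blast
qed

section \<open>Mistake counts of experts, day by day\<close>

lemma expert_mistakes_Nil: "expert_mistakes [] i = 0"
  by (simp add: expert_mistakes_def)

lemma expert_mistakes_Cons:
  "expert_mistakes ((ps, y) # days) i = of_bool (ps ! i \<noteq> y) + expert_mistakes days i"
proof -
  have "{t. t < length ((ps, y) # days) \<and> fst (((ps, y) # days) ! t) ! i \<noteq> snd (((ps, y) # days) ! t)}
    = (if ps ! i \<noteq> y then {0} else {}) \<union> Suc ` {t. t < length days \<and> fst (days ! t) ! i \<noteq> snd (days ! t)}"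
    (is "?L = ?Z \<union> Suc ` ?R")
    by (auto simp: less_Suc_eq_0_disj image_iff split: if_splits)
  then have "card ?L = card ?Z + card (Suc ` ?R)"
    by (subst card_Un_disjoint[symmetric]) auto
  then show ?thesis
    by (simp add: expert_mistakes_def card_image)
qed

section \<open>Halving with cyclic blocks\<close>

definition plurality :: "nat set \<Rightarrow> ('x::finite) list \<Rightarrow> 'x" where
  "plurality V b = (SOME x. \<forall>y. card {j \<in> V. b ! j = y} \<le> card {j \<in> V. b ! j = x})"

lemma plurality_max:
  "card {j \<in> V. b ! j = y} \<le> card {j \<in> V. b ! j = plurality V b}"
proof -
  let ?c = "\<lambda>x. card {j \<in> V. b ! j = x}"
  have "Max (range ?c) \<in> range ?c" by (rule Max_in) auto
  then obtain x where x: "?c x = Max (range ?c)" by force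
  have "?c y \<le> ?c x" for y unfolding x by (rule Max_ge) auto
  then have "\<exists>x. \<forall>y. ?c y \<le> ?c x" by blast
  then show ?thesis unfolding plurality_def by (rule someI2_ex) blast
qed

text \<open>The voters for \<open>y\<close> and those for the plurality value are disjoint, and the
  former are not more numerous. This works for any finite number of values.\<close>

lemma plurality_wrong_halves:
  assumes "finite V" "plurality V b \<noteq> y"
  shows "2 * card {j \<in> V. b ! j = y} \<le> card V"
proof -
  have "card {j \<in> V. b ! j = y} + card {j \<in> V. b ! j = plurality V b}
      = card ({j \<in> V. b ! j = y} \<union> {j \<in> V. b ! j = plurality V b})"
    using assms by (intro card_Un_disjoint[symmetric]) auto
  also have "\<dots> \<le> card V" using assms by (intro card_mono) auto
  finally show ?thesis using plurality_max[of V b y] by linarith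
qed

text \<open>Experts are named by their offset inside the block, so a set of survivors costs
  \<open>k\<close> bits whatever the block. The last block may be shorter.\<close>

definition block :: "nat \<Rightarrow> nat \<Rightarrow> nat \<Rightarrow> nat set" where
  "block n k g = {j. j < k \<and> g * k + j < n}"

text \<open>\<open>V\<close> consists of the offsets of the experts that have not erred in the
  current phase.\<close>

definition halving_update ::
    "nat \<Rightarrow> nat \<Rightarrow> nat \<Rightarrow> nat \<times> nat set \<Rightarrow> 'x list \<Rightarrow> 'x \<Rightarrow> nat \<times> nat set" where
  "halving_update n k G = (\<lambda>(g, V) b y.
     let V' = {j \<in> V. b ! j = y} in
     if V' = {} then (Suc g mod G, block n k (Suc g mod G)) else (g, V'))"

abbreviation halving_mistakes ::
    "nat \<Rightarrow> nat \<Rightarrow> nat \<Rightarrow> nat \<times> nat set \<Rightarrow> ('x::finite) day list \<Rightarrow> nat" where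
  "halving_mistakes n k G \<equiv>
     day_mistakes (\<lambda>(g, V). g * k) k (\<lambda>(g, V) b. plurality V b) (halving_update n k G)"

text \<open>The number of further phases that begin before expert \<open>j\<close> of block \<open>h\<close> must err again.\<close>

definition phases_left :: "nat \<Rightarrow> nat \<Rightarrow> nat \<Rightarrow> nat \<times> nat set \<Rightarrow> nat" where
  "phases_left G h j = (\<lambda>(g, V). if g = h then (if j \<in> V then 0 else G)
                                   else if g < h then h - g else h + G - g)"

text \<open>The right-hand side is a potential. A wrong vote inside a phase lowers
  \<open>log 2 (card V)\<close> by at least 1, and the summand 1 pays for a mistake that ends the
  phase. Each later phase is prepaid with \<open>1 + log 2 k\<close>; a mistake of the chosen expert
  accounts for \<open>G\<close> of them, one full cycle through the blocks.\<close>

lemma halving_mistakes_bound: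
  fixes days :: "('x::finite) day list"
  assumes k: "k \<ge> 1" and G: "\<And>g. g < G \<Longrightarrow> g * k < n"
    and e: "h < G" "j < k" "h * k + j < n"
    and "g < G" "V \<noteq> {}" "V \<subseteq> block n k g" "\<forall>d\<in>set days. length (fst d) = n"
  shows "real (halving_mistakes n k G (g, V) days) \<le>
    1 + log 2 (card V) + (1 + log 2 k) *
      real (expert_mistakes days (h * k + j) * G + phases_left G h j (g, V))"
  using assms(6-)
proof (induction days arbitrary: g V)
  case Nil
  have "finite V" using Nil by (auto simp: block_def intro: finite_subset)
  then have "card V \<ge> 1" using Nil by (simp add: Suc_le_eq card_gt_0_iff)
  then show ?case using k by (simp add: expert_mistakes_Nil)
next
  case (Cons d days)
  obtain ps y where d: "d = (ps, y)" by fastforce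
  have len: "length ps = n" using Cons.prems d by simp
  define b where "b = take k (drop (g * k) ps)"
  define V' where "V' = {i \<in> V. b ! i = y}"
  define H where "H = 1 + log 2 k"
  define c where "c = expert_mistakes days (h * k + j)"
  have H: "H \<ge> 1" using k by (simp add: H_def)
  have b: "b ! i = ps ! (g * k + i)" if "i < k" "g * k + i < n" for i
    using that len by (simp add: b_def)
  have finV: "finite V" using Cons.prems by (auto simp: block_def intro: finite_subset)
  then have cV: "card V \<ge> 1" using Cons.prems by (simp add: Suc_le_eq card_gt_0_iff)
  have jV': "j \<in> V' \<longleftrightarrow> j \<in> V \<and> ps ! (h * k + j) = y" if "g = h"
    using that e b[of j] by (auto simp: V'_def)
  let ?m = "if plurality V b = y then 0 else 1 :: nat"
  have hm: "halving_mistakes n k G (g, V) (d # days) =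
      ?m + halving_mistakes n k G (halving_update n k G (g, V) b y) days"
    by (simp add: d b_def Let_def)
  have em: "expert_mistakes (d # days) (h * k + j) = of_bool (ps ! (h * k + j) \<noteq> y) + c"
    by (simp add: d expert_mistakes_Cons c_def)
  show ?case
  proof (cases "V' = {}")
    case True
    let ?g = "Suc g mod G"
    have g': "?g < G" using Cons.prems(1) by simp
    then have ne: "block n k ?g \<noteq> {}"
      using G[of ?g] k by (auto simp: block_def intro!: exI[of _ 0])
    have "card (block n k ?g) \<le> card {..<k}" by (intro card_mono) (auto simp: block_def)
    moreover have "card (block n k ?g) > 0" using ne by (simp add: card_gt_0_iff block_def)
    ultimately have cb: "1 + log 2 (card (block n k ?g)) \<le> H" by (simp add: H_def)
    have upd: "halving_update n k G (g, V) b y = (?g, block n k ?g)"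
      using True by (simp add: halving_update_def V'_def)
    \<comment> \<open>The new phase uses up one unit of the phase count. If it leaves block
      \<open>h\<close>, then \<open>G\<close> units were available: from the mistake just made if
      \<open>j\<close> was still in \<open>V\<close>, from \<open>phases_left\<close>
      otherwise.\<close>
    have "c * G + phases_left G h j (?g, block n k ?g) + 1
        \<le> expert_mistakes (d # days) (h * k + j) * G + phases_left G h j (g, V)"
    proof -
      have jb: "j \<in> block n k h" using e by (simp add: block_def)
      have "ps ! (h * k + j) \<noteq> y" if "g = h" "j \<in> V" using that jV' True by auto
      moreover have "phases_left G h j (?g, block n k ?g) + 1 \<le>
          (if g = h then G else phases_left G h j (g, V))"
      proof (cases "Suc g = G")
        case True
        then show ?thesis using e(1) jb by (auto simp: phases_left_def)
      next
        case False
        then have "?g = Suc g" using Cons.prems(1) by simp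
        then show ?thesis using Cons.prems(1) e(1) jb by (auto simp: phases_left_def)
      qed
      ultimately show ?thesis
        by (cases "g = h"; cases "j \<in> V") (simp_all add: em phases_left_def add_mult_distrib)
    qed
    then have ph: "real (c * G + phases_left G h j (?g, block n k ?g)) + 1
        \<le> real (expert_mistakes (d # days) (h * k + j) * G + phases_left G h j (g, V))"
      (is "?x + 1 \<le> ?z") by linarith
    have "real (halving_mistakes n k G (?g, block n k ?g) days) \<le> H + H * ?x"
      using Cons.IH[of ?g "block n k ?g"] g' ne Cons.prems cb by (simp add: c_def H_def)
    also have "\<dots> = H * (?x + 1)" by (simp add: algebra_simps)
    also have "\<dots> \<le> H * ?z" using ph H by (intro mult_left_mono) auto
    finally have "real (halving_mistakes n k G (?g, block n k ?g) days) \<le> H * ?z" .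
    \<comment> \<open>Hence the old potential without its phase part is at least 1 and covers a
      mistake on the last day of the phase.\<close>
    moreover have "log 2 (card V) \<ge> 0" using cV by simp
    ultimately show ?thesis unfolding hm upd H_def by simp
  next
    case False
    have upd: "halving_update n k G (g, V) b y = (g, V')"
      unfolding halving_update_def prod.case Let_def V'_def[symmetric] using False by simp
    have cV': "card V' > 0" using False finV by (simp add: card_gt_0_iff V'_def)
    have cle: "card V' \<le> card V" using finV by (auto simp: V'_def intro: card_mono)
    have lg: "real ?m + log 2 (card V') \<le> log 2 (card V)"
    proof (cases "plurality V b = y")
      case True
      then show ?thesis using cV' cle by simp
    next
      case wrong: False
      then have "2 * card V' \<le> card V"
        using plurality_wrong_halves[of V b y] finV by (simp add: V'_def)
      then have "log 2 (2 * real (card V')) \<le> log 2 (card V)"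
        using cV' by (subst log_le_cancel_iff) auto
      then show ?thesis using wrong cV' by (simp add: log_mult)
    qed
    \<comment> \<open>If \<open>j\<close> drops out of \<open>V\<close> while the phase goes on, its
      mistake releases \<open>G\<close> units and \<open>phases_left\<close> rises from 0 to
      \<open>G\<close>.\<close>
    have "c * G + phases_left G h j (g, V')
        \<le> expert_mistakes (d # days) (h * k + j) * G + phases_left G h j (g, V)"
      using jV' by (auto simp: em phases_left_def)
    then have ph: "real (c * G + phases_left G h j (g, V'))
        \<le> real (expert_mistakes (d # days) (h * k + j) * G + phases_left G h j (g, V))"
      (is "?x \<le> ?z") by linarith
    have "V' \<subseteq> block n k g" using Cons.prems by (auto simp: V'_def)
    then have "real (halving_mistakes n k G (g, V') days) \<le> 1 + log 2 (card V') + H * ?x"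
      using Cons.IH[of g V'] False Cons.prems by (simp add: c_def H_def)
    also have "H * ?x \<le> H * ?z" using ph H by (intro mult_left_mono) auto
    finally have "real (halving_mistakes n k G (g, V') days) \<le> 1 + log 2 (card V') + H * ?z"
      by simp
    then show ?thesis unfolding hm upd using lg unfolding H_def of_nat_add by linarith
  qed
qed

lemma best_expert:
  assumes "n \<ge> 1"
  obtains e where "e < n" "best_mistakes n days = expert_mistakes days e"
proof -
  have "best_mistakes n days \<in> expert_mistakes days ` {..<n}"
    unfolding best_mistakes_def using assms by (intro Min_in) (auto simp: lessThan_empty_iff)
  then show ?thesis using that by auto
qed

text \<open>The state is a block number and a set of offsets; the potential bound is applied to the
  block and offset of a best expert. Neither \<open>T\<close> nor \<open>M\<close> enters the
  algorithm.\<close>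

lemma block_halving_alg:
  assumes n: "n \<ge> 1" and k: "1 \<le> k"
    and s: "real n * real (n + 1) * 2 ^ k * real (CARD('x) + 1) ^ k \<le> 2 ^ s"
  obtains A :: "('x::finite) stream_alg" where "uses_space A s"
    "\<And>T days. expert_stream n T days \<Longrightarrow>
       real (alg_mistakes A days) \<le> (1 + log 2 k) * (real n / real k + 1) * (best_mistakes n days + 1)"
proof -
  \<comment> \<open>This is \<open>n / k\<close> rounded up, so that every block is
    nonempty.\<close>
  define G where "G = (n - 1) div k + 1"
  have Gn: "G \<le> n" unfolding G_def using n div_le_dividend[of "n - 1" k] by linarith
  have G: "g * k < n" if "g < G" for g
  proof -
    have "g * k \<le> (n - 1) div k * k" using that by (simp add: G_def)
    also have "\<dots> \<le> n - 1" by (rule div_times_less_eq_dividend)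
    finally show ?thesis using n by linarith
  qed
  have G_real: "real G \<le> real n / real k + 1"
  proof -
    have "real ((n - 1) div k) \<le> real (n - 1) / real k" by (rule of_nat_div_le_of_nat)
    also have "\<dots> \<le> real n / real k" by (intro divide_right_mono) auto
    finally show ?thesis by (simp add: G_def)
  qed
  define D where "D = {..<G} \<times> Pow {..<k}"
  have "card D * (n + 1) * (CARD('x) + 1) ^ k \<le> n * 2 ^ k * (n + 1) * (CARD('x) + 1) ^ k"
    using Gn by (intro mult_right_mono) (auto simp: D_def card_cartesian_product card_Pow)
  moreover have "real (n * 2 ^ k * (n + 1) * (CARD('x) + 1) ^ k) \<le> real (2 ^ s)"
    using s by (simp only: of_nat_mult of_nat_power of_nat_numeral mult_ac)
  ultimately have cD: "card D * (n + 1) * (CARD('x) + 1) ^ k \<le> 2 ^ s"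
    unfolding of_nat_le_iff by (rule order_trans)
  have "block n k g \<subseteq> {..<k}" for g by (auto simp: block_def)
  then have D: "finite D" "(0, block n k 0) \<in> D"
    "\<And>\<sigma> b y. \<sigma> \<in> D \<Longrightarrow> halving_update n k G \<sigma> b (y :: 'x) \<in> D"
    by (auto simp: D_def G_def halving_update_def Let_def)
  obtain A :: "'x stream_alg" where A: "uses_space A s"
    "\<And>T days. expert_stream n T days \<Longrightarrow>
       alg_mistakes A days = halving_mistakes n k G (0, block n k 0) days"
    using stream_alg_of_day_automaton[where U = "halving_update n k G" and D = D, OF D cD] by blast
  show ?thesis
  proof
    show "uses_space A s" by fact
    fix T days
    assume days: "expert_stream n T (days :: 'x day list)"
    obtain e where e: "e < n" "best_mistakes n days = expert_mistakes days e"
      using best_expert[OF n] .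
    have eh: "e div k < G" using e(1) by (simp add: G_def div_le_mono less_Suc_eq_le)
    have ne: "block n k 0 \<noteq> {}" using n k by (auto simp: block_def intro!: exI[of _ 0])
    have "card (block n k 0) \<le> card {..<k}" by (intro card_mono) (auto simp: block_def)
    moreover have "card (block n k 0) > 0" using ne by (simp add: card_gt_0_iff block_def)
    ultimately have cb: "log 2 (card (block n k 0)) \<le> log 2 k" by simp
    have em: "e mod k < k" "e div k * k + e mod k = e" using k by auto
    let ?\<delta> = "phases_left G (e div k) (e mod k) (0, block n k 0)"
    \<comment> \<open>Block 0 starts with all its experts alive, so \<open>?\<delta>\<close> is the
      number of the block of \<open>e\<close>. The added 1 stands for the first phase.\<close>
    have ph: "?\<delta> + 1 \<le> G"
      using eh em e(1) mod_less_eq_dividend[of e k]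
      by (auto simp: phases_left_def block_def simp del: mod_less_eq_dividend)
    let ?c = "best_mistakes n days"
    have "real (alg_mistakes A days) \<le> 1 + log 2 (card (block n k 0)) + (1 + log 2 k) * real (?c * G + ?\<delta>)"
      using halving_mistakes_bound[of k G n "e div k" "e mod k" 0 "block n k 0" days]
        k G eh em e ne days A(2)[OF days] by (simp add: expert_stream_def G_def)
    also have "\<dots> \<le> (1 + log 2 k) + (1 + log 2 k) * real (?c * G + ?\<delta>)" using cb by simp
    also have "\<dots> = (1 + log 2 k) * real (?c * G + (?\<delta> + 1))" by (simp add: algebra_simps)
    also have "\<dots> \<le> (1 + log 2 k) * real (?c * G + G)"
      using ph k by (intro mult_left_mono) auto
    also have "\<dots> = (1 + log 2 k) * real G * (real ?c + 1)" by (simp add: algebra_simps)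
    also have "\<dots> \<le> (1 + log 2 k) * (real n / real k + 1) * (real ?c + 1)"
      using G_real k by (intro mult_right_mono mult_left_mono) auto
    finally show "real (alg_mistakes A days) \<le> (1 + log 2 k) * (real n / real k + 1) * real (?c + 1)"
      by (simp add: add.commute)
  qed
qed

section \<open>Positional strategies for the prediction game\<close>

definition add_mistakes :: "nat list \<Rightarrow> 'x list \<Rightarrow> 'x \<Rightarrow> nat list" where
  "add_mistakes c ps y = map2 (\<lambda>a p. a + of_bool (p \<noteq> y)) c ps"

lemma length_add_mistakes [simp]:
  "length c = n \<Longrightarrow> length ps = n \<Longrightarrow> length (add_mistakes c ps y) = n"
  by (simp add: add_mistakes_def)

lemma nth_add_mistakes [simp]:
  "i < length c \<Longrightarrow> i < length ps \<Longrightarrow> add_mistakes c ps y ! i = c ! i + of_bool (ps ! i \<noteq> y)"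
  by (simp add: add_mistakes_def)

text \<open>The adversary shows the predictions, the algorithm answers, and then the adversary fixes
  the outcome. As \<open>W\<close> judges final counts only, days left and current counts form a
  complete position. The \<open>itself\<close> argument fixes the type of predictions.\<close>

fun winning :: "nat \<Rightarrow> (nat list \<Rightarrow> nat \<Rightarrow> bool) \<Rightarrow> 'x itself \<Rightarrow> nat \<Rightarrow> nat list \<Rightarrow> nat \<Rightarrow> bool" where
  "winning n W X 0 c a = W c a"
| "winning n W X (Suc r) c a = (\<forall>ps :: 'x list. length ps = n \<longrightarrow>
     (\<exists>p. \<forall>y. winning n W X r (add_mistakes c ps y) (a + of_bool (p \<noteq> y))))"

definition total_mistakes :: "nat list \<Rightarrow> 'x day list \<Rightarrow> nat list" where
  "total_mistakes c days = map (\<lambda>i. c ! i + expert_mistakes days i) [0..<length c]"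

lemma total_mistakes_Nil: "total_mistakes c [] = c"
  by (simp add: total_mistakes_def expert_mistakes_Nil map_nth)

lemma total_mistakes_Cons:
  assumes "length c = length ps"
  shows "total_mistakes c ((ps, y) # days) = total_mistakes (add_mistakes c ps y) days"
  using assms
  by (intro nth_equalityI) (simp_all add: total_mistakes_def expert_mistakes_Cons)

text \<open>In every position the prediction of \<open>B\<close> serves as the winning move; its
  memory \<open>m\<close> is carried along in the induction but does not occur in the
  conclusion.\<close>

lemma winning_if_algorithm:
  fixes B :: "'x stream_alg"
  assumes "length c = n"
    "\<And>days. expert_stream n r days \<Longrightarrow> W (total_mistakes c days) (a + mistakes_from B m days)"
  shows "winning n W TYPE('x) r c a"
  using assms
proof (induction r arbitrary: c a m)
  case 0
  have "expert_stream n 0 ([] :: 'x day list)" by (simp add: expert_stream_def)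
  from 0(2)[OF this] show ?case by (simp add: total_mistakes_Nil)
next
  case (Suc r)
  have "\<exists>p. \<forall>y. winning n W TYPE('x) r (add_mistakes c ps y) (a + of_bool (p \<noteq> y))"
    if ps: "length ps = n" for ps :: "'x list"
  proof (intro exI allI)
    fix y
    let ?m = "foldl (read_prediction B) m ps"
    show "winning n W TYPE('x) r (add_mistakes c ps y) (a + of_bool (predict B ?m \<noteq> y))"
    proof (rule Suc.IH)
      show "length (add_mistakes c ps y) = n" using Suc.prems(1) ps by simp
      fix days :: "'x day list"
      assume "expert_stream n r days"
      then have "expert_stream n (Suc r) ((ps, y) # days)"
        using ps by (simp add: expert_stream_def)
      from Suc.prems(2)[OF this]
      show "W (total_mistakes (add_mistakes c ps y) days)
          (a + of_bool (predict B ?m \<noteq> y) + mistakes_from B (read_outcome B ?m y) days)"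
        using Suc.prems(1) ps by (cases "predict B ?m = y") (simp_all add: total_mistakes_Cons)
    qed
  qed
  then show ?case by simp
qed

text \<open>Any move that keeps the position winning. The number \<open>r\<close> includes the
  current day, hence \<open>r - 1\<close>.\<close>

definition strategy :: "nat \<Rightarrow> (nat list \<Rightarrow> nat \<Rightarrow> bool) \<Rightarrow> nat \<times> nat list \<times> nat \<Rightarrow> 'x list \<Rightarrow> 'x" where
  "strategy n W = (\<lambda>(r, c, a) ps.
     SOME p. \<forall>y. winning n W TYPE('x) (r - 1) (add_mistakes c ps y) (a + of_bool (p \<noteq> y)))"

text \<open>The guard keeps the finite state set closed under updates on malformed input.\<close>

definition strategy_update :: "nat \<Rightarrow> (nat list \<Rightarrow> nat \<Rightarrow> bool) \<Rightarrow>
    nat \<times> nat list \<times> nat \<Rightarrow> 'x list \<Rightarrow> 'x \<Rightarrow> nat \<times> nat list \<times> nat" where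
  "strategy_update n W = (\<lambda>(r, c, a) ps y. if r = 0 \<or> length ps \<noteq> n then (r, c, a)
     else (r - 1, add_mistakes c ps y, a + of_bool (strategy n W (r, c, a) ps \<noteq> y)))"

lemma strategy_wins:
  fixes days :: "'x day list"
  assumes "winning n W TYPE('x) r c a" "length c = n" "expert_stream n r days"
  shows "W (total_mistakes c days)
    (a + day_mistakes (\<lambda>_. 0) n (strategy n W) (strategy_update n W) (r, c, a) days)"
  using assms
proof (induction r arbitrary: c a days)
  case 0
  then show ?case by (simp add: total_mistakes_Nil expert_stream_def)
next
  case (Suc r)
  obtain ps y days' where days: "days = (ps, y) # days'" "length ps = n" "expert_stream n r days'"
    using Suc.prems(3) by (cases days) (auto simp: expert_stream_def)
  let ?p = "strategy n W (Suc r, c, a) ps"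
  have "\<exists>p. \<forall>y. winning n W TYPE('x) r (add_mistakes c ps y) (a + of_bool (p \<noteq> y))"
    using Suc.prems(1) days(2) by simp
  then have "\<forall>y. winning n W TYPE('x) r (add_mistakes c ps y) (a + of_bool (?p \<noteq> y))"
    unfolding strategy_def prod.case diff_Suc_1 by (rule someI_ex)
  then have "W (total_mistakes (add_mistakes c ps y) days') (a + of_bool (?p \<noteq> y) +
      day_mistakes (\<lambda>_. 0) n (strategy n W) (strategy_update n W)
        (r, add_mistakes c ps y, a + of_bool (?p \<noteq> y)) days')"
    using Suc.prems(2) days by (intro Suc.IH) auto
  then show ?case
    using Suc.prems(2) days
    by (cases "?p = y") (simp_all add: total_mistakes_Cons strategy_update_def)
qed

text \<open>Whatever memory \<open>B\<close> uses, the game is won, and the positional strategy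
  stores just \<open>n + 2\<close> numbers up to \<open>T\<close> between days.\<close>

lemma counting_alg:
  fixes B :: "('x::finite) stream_alg"
  assumes n: "n \<ge> 1" and B: "achieves_regret B n T M R"
    and s: "real (T + 1) ^ (n + 2) * real (n + 1) * real (CARD('x) + 1) ^ n \<le> 2 ^ s"
  obtains A :: "'x stream_alg" where "uses_space A s" "achieves_regret A n T M R"
proof -
  \<comment> \<open>The regret condition in terms of final counts: the minimum of \<open>c\<close>
    is the number of mistakes of the best expert.\<close>
  define W where "W = (\<lambda>c a. Min (set c) \<le> M \<longrightarrow> real a \<le> real (Min (set c)) + R * real T)"
  define c0 where "c0 = replicate n (0::nat)"
  have best: "Min (set (total_mistakes c0 days)) = best_mistakes n days" for days :: "'x day list"
    by (simp add: total_mistakes_def best_mistakes_def c0_def atLeast0LessThan cong: image_cong_simp)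
  have "winning n W TYPE('x) T c0 0"
  proof (rule winning_if_algorithm)
    show "length c0 = n" by (simp add: c0_def)
    show "W (total_mistakes c0 days) (0 + mistakes_from B (init_mem B) days)"
      if "expert_stream n T days" for days
      using B that by (simp add: W_def best achieves_regret_def alg_mistakes_def)
  qed
  note win = strategy_wins[OF this]
  \<comment> \<open>A count grows by at most 1 on a day while \<open>r\<close> drops by 1, so the
    sums with \<open>r\<close> stay below \<open>T\<close>.\<close>
  define D where "D = {(r, c, a). r \<le> T \<and> length c = n \<and> (\<forall>x\<in>set c. x + r \<le> T) \<and> a + r \<le> T}"
  let ?E = "{..T} \<times> {c. set c \<subseteq> {..T} \<and> length c = n} \<times> {..T}"
  have DE: "D \<subseteq> ?E" by (auto simp: D_def)
  have finE: "finite ?E" using finite_lists_length_eq[of "{..T}" n] by auto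
  have "card D \<le> card ?E" using DE finE by (rule card_mono[rotated])
  also have "card ?E = (T + 1) ^ (n + 2)"
    by (simp add: card_cartesian_product card_lists_length_eq mult_ac)
  finally have "card D * (n + 1) * (CARD('x) + 1) ^ n \<le> (T + 1) ^ (n + 2) * (n + 1) * (CARD('x) + 1) ^ n"
    by (intro mult_right_mono) auto
  moreover have "real ((T + 1) ^ (n + 2) * (n + 1) * (CARD('x) + 1) ^ n) \<le> real (2 ^ s)"
    using s by (simp only: of_nat_mult of_nat_power of_nat_numeral)
  ultimately have cD: "card D * (n + 1) * (CARD('x) + 1) ^ n \<le> 2 ^ s"
    unfolding of_nat_le_iff by (rule order_trans)
  have D: "finite D" "(T, c0, 0) \<in> D" using finite_subset[OF DE finE] by (auto simp: D_def c0_def)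
  have upd: "strategy_update n W \<sigma> b y \<in> D" if "\<sigma> \<in> D" for \<sigma> b and y :: 'x
  proof -
    obtain r c a where \<sigma>: "\<sigma> = (r, c, a)" by (cases \<sigma>)
    show ?thesis
    proof (cases "r = 0 \<or> length b \<noteq> n")
      case True
      then show ?thesis using that by (auto simp: \<sigma> strategy_update_def)
    next
      case False
      have "x + (r - 1) \<le> T" if x: "x \<in> set (add_mistakes c b y)" for x
      proof -
        obtain i where i: "i < n" "x = add_mistakes c b y ! i"
          using x False \<open>\<sigma> \<in> D\<close> unfolding in_set_conv_nth by (auto simp: \<sigma> D_def)
        then have "x \<le> c ! i + 1" "c ! i + r \<le> T"
          using False \<open>\<sigma> \<in> D\<close> by (auto simp: \<sigma> D_def)
        with False show ?thesis by linarith
      qed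
      then show ?thesis using False that by (auto simp: \<sigma> strategy_update_def D_def)
    qed
  qed
  obtain A :: "'x stream_alg" where A: "uses_space A s"
    "\<And>T' days. expert_stream n T' days \<Longrightarrow> alg_mistakes A days =
       day_mistakes (\<lambda>_. 0) n (strategy n W) (strategy_update n W) (T, c0, 0) days"
    using stream_alg_of_day_automaton[where U = "strategy_update n W" and D = D, OF D upd cD] by blast
  have "achieves_regret A n T M R"
    unfolding achieves_regret_def
  proof (intro allI impI)
    fix days :: "'x day list"
    assume "expert_stream n T days \<and> best_mistakes n days \<le> M"
    then show "real (alg_mistakes A days) \<le> real (best_mistakes n days) + R * real T"
      using win[of days] A(2)[of T days] by (simp add: W_def best c0_def[symmetric]) (simp add: c0_def)
  qed
  with A(1) show ?thesis using that by blast
qed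

section \<open>Space bounds\<close>

lemma bits_for_bound:
  assumes "N \<ge> (1::real)"
  obtains s :: nat where "N \<le> 2 ^ s" "real s \<le> log 2 N + 1"
proof
  let ?s = "nat \<lceil>log 2 N\<rceil>"
  have "log 2 N \<ge> 0" using assms by simp
  then show "real ?s \<le> log 2 N + 1" by linarith
  have "N = 2 powr log 2 N" using assms by simp
  also have "\<dots> \<le> 2 powr real ?s" by (intro powr_mono) linarith+
  finally show "N \<le> 2 ^ ?s" by (simp add: powr_realpow)
qed

text \<open>This uses \<open>ln 2 \<ge> 1/2\<close>, which follows from
  \<open>exp 1 \<le> 4\<close>.\<close>

lemma log2_le_twice_ln:
  assumes "1 \<le> x" "x \<le> y" shows "log 2 x \<le> 2 * ln (y::real)"
proof -
  have "1 \<le> ln (4::real)" using exp_le by (subst ln_ge_iff) auto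
  then have "ln 2 \<ge> (1/2 :: real)" using ln_realpow[of 2 2] by simp
  moreover have "0 \<le> ln x" "ln x \<le> ln y" using assms by auto
  ultimately have "ln x \<le> 2 * ln y * ln 2"
    using mult_mono[of "ln x" "ln y" "1/2" "ln 2"] by simp
  then show ?thesis by (simp add: log_def divide_le_eq)
qed

text \<open>For large regret the block size \<open>k\<close> is taken just large enough for block
  halving to make at most \<open>R * T\<close> mistakes; the space is then about \<open>k\<close>
  bits.\<close>

lemma halving_case:
  fixes R :: real
  assumes n: "n \<ge> 1" and T: "T \<ge> 1" and R: "R > 0"
    and large: "R * T \<ge> 8 * real (max 1 M) * log 2 (real n + 1)"
  obtains A :: "('x::finite) stream_alg" and s where "uses_space A s"
    "s \<le> 160 * (1 + log 2 (CARD('x) + 1)) * ln (real n * real T + 2) ^ 2 * space_bound n T M R"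
    "achieves_regret A n T M R"
proof -
  define l where "l = log 2 (real n + 1)"
  define L where "L = ln (real n * real T + 2)"
  define M' where "M' = real (max 1 M)"
  \<comment> \<open>Bits per expert of a block: one for membership in \<open>V\<close>, the
    logarithm for its buffered prediction.\<close>
  define \<alpha> where "\<alpha> = 1 + log 2 (real CARD('x) + 1)"
  define B where "B = space_bound n T M R"
  \<comment> \<open>Then \<open>n / k\<close> is at most \<open>R * T / (8 * M' * l)\<close>. The
    assumption \<open>large\<close> gives \<open>k \<le> n\<close> and lets the same quantity absorb
    the 1 from rounding up the number of blocks.\<close>
  define k where "k = nat \<lceil>8 * M' * n * l / (R * T)\<rceil>"
  have l: "l \<ge> 1" using n by (simp add: l_def)
  have M': "M' \<ge> 1" "real M \<le> M'" by (simp_all add: M'_def)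
  have RT: "R * T > 0" using R T by simp
  have large': "8 * M' * l \<le> R * T" using large by (simp add: M'_def l_def)
  have pos: "8 * M' * n * l / (R * T) > 0" using n l M' RT by simp
  have k1: "k \<ge> 1" using pos unfolding k_def by linarith
  have k_ge: "8 * M' * n * l / (R * T) \<le> k" unfolding k_def by linarith
  have k_le: "k \<le> 8 * M' * n * l / (R * T) + 1" using pos unfolding k_def by linarith
  have "8 * M' * n * l / (R * T) \<le> n"
    using mult_right_mono[OF large', of "real n"] RT by (simp add: divide_le_eq mult_ac)
  then have kn: "k \<le> n" unfolding k_def by linarith
  have "log 2 k \<le> l" using kn k1 by (simp add: l_def)
  then have lk: "1 + log 2 k \<le> 2 * l" using l by linarith
  have "real n * (8 * M' * l) \<le> k * (R * T)" using k_ge RT by (simp add: divide_le_eq mult_ac)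
  then have "real n / k \<le> R * T / (8 * M' * l)"
    using k1 M' l by (simp add: divide_le_eq le_divide_eq mult_ac)
  moreover have "1 \<le> R * T / (8 * M' * l)" using large' M' l by (simp add: le_divide_eq)
  ultimately have nk: "real n / k + 1 \<le> R * T / (4 * M' * l)" by simp
  let ?N = "real n * real (n + 1) * 2 ^ k * real (CARD('x) + 1) ^ k"
  have N1: "?N \<ge> 1" using n by (intro mult_ge1_I one_le_power) auto
  obtain s where s: "?N \<le> 2 ^ s" "real s \<le> log 2 ?N + 1" using bits_for_bound[OF N1] .
  obtain A :: "'x stream_alg" where A: "uses_space A s"
    "\<And>T days. expert_stream n T days \<Longrightarrow>
       real (alg_mistakes A days) \<le> (1 + log 2 k) * (real n / real k + 1) * (best_mistakes n days + 1)"
    using block_halving_alg[OF n k1 s(1)] by blast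
  have "achieves_regret A n T M R"
    unfolding achieves_regret_def
  proof (intro allI impI)
    fix days :: "'x day list"
    assume days: "expert_stream n T days \<and> best_mistakes n days \<le> M"
    then have b: "real (best_mistakes n days + 1) \<le> 2 * M'" using M' by linarith
    have "real (alg_mistakes A days) \<le> (1 + log 2 k) * (real n / real k + 1) * (best_mistakes n days + 1)"
      using A(2) days by blast
    \<comment> \<open>The three factors multiply to exactly \<open>R * T\<close>, which bounds all
      mistakes and not only the excess over the best expert.\<close>
    also have "\<dots> \<le> 2 * l * (R * T / (4 * M' * l)) * (2 * M')"
      using lk nk b l M' RT k1 by (intro mult_mono) auto
    also have "\<dots> = R * T" using l M' by simp
    finally show "real (alg_mistakes A days) \<le> real (best_mistakes n days) + R * real T" by simp
  qed
  moreover have "s \<le> 160 * \<alpha> * L ^ 2 * B"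
  proof -
    have nT: "real n \<le> real n * T" using mult_left_mono[of 1 "real T" "real n"] T by simp
    have B: "B \<ge> 1" "n * M' / (R * T) \<le> B" by (simp_all add: B_def space_bound_def M'_def)
    have \<alpha>: "\<alpha> \<ge> 1" by (simp add: \<alpha>_def)
    have lL: "l \<le> 2 * L" unfolding l_def L_def using nT by (intro log2_le_twice_ln) auto
    have "exp 1 \<le> real n * T + 2"
      using exp_le nT n by linarith
    then have L1: "L \<ge> 1" unfolding L_def by (subst ln_ge_iff) (auto intro: add_nonneg_pos)
    have LB: "L \<le> L * B" "1 \<le> L * B" using B L1 mult_mono[of 1 L 1 B] by auto
    have "log 2 ?N = log 2 n + l + k + k * (\<alpha> - 1)"
      using n by (simp add: log_mult log_nat_power l_def \<alpha>_def add.commute)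
    also have "\<dots> = log 2 n + l + k * \<alpha>" by (simp add: algebra_simps)
    also have "log 2 n \<le> l" using n by (simp add: l_def)
    finally have sk: "s \<le> 1 + 2 * l + k * \<alpha>" using s(2) by simp
    have "real k \<le> 8 * l * (n * M' / (R * T)) + 1" using k_le by (simp add: mult_ac)
    also have "\<dots> \<le> 8 * (2 * L) * B + 1"
      using lL B l L1 M' RT by (intro add_right_mono mult_mono) auto
    also have "\<dots> \<le> 17 * (L * B)" using LB by linarith
    finally have "k * \<alpha> \<le> 17 * (L * B) * \<alpha>" using \<alpha> by (intro mult_right_mono) auto
    then have "s \<le> 5 * (L * B) * 1 + 17 * (L * B) * \<alpha>" using sk lL LB by simp
    also have "\<dots> \<le> 5 * (L * B) * \<alpha> + 17 * (L * B) * \<alpha>"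
      using \<alpha> LB by (intro add_right_mono mult_left_mono) auto
    also have "\<dots> = 22 * \<alpha> * (L * B) * 1" by simp
    \<comment> \<open>Weakened to the constant and the power of \<open>L\<close> that the counting
      case produces.\<close>
    also have "\<dots> \<le> 160 * \<alpha> * (L * B) * L"
      using \<alpha> LB L1 by (intro mult_mono) auto
    finally show ?thesis by (simp add: power2_eq_square mult_ac)
  qed
  ultimately show ?thesis
    using that A(1) by (simp add: L_def \<alpha>_def B_def add.commute)
qed

text \<open>For small regret \<open>n M' / (R T)\<close> exceeds \<open>n / (8 * l)\<close>, so the
  space bound leaves room for a counter per expert.\<close>

lemma counting_case:
  fixes R :: real and Bob :: "('x::finite) stream_alg"
  assumes n: "n \<ge> 1" and T: "T \<ge> 1" and R: "R > 0"
    and small: "R * T < 8 * real (max 1 M) * log 2 (real n + 1)"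
    and feasible: "achieves_regret Bob n T M R"
  obtains A :: "'x stream_alg" and s where "uses_space A s"
    "s \<le> 160 * (1 + log 2 (CARD('x) + 1)) * ln (real n * real T + 2) ^ 2 * space_bound n T M R"
    "achieves_regret A n T M R"
proof -
  define l where "l = log 2 (real n + 1)"
  define L where "L = ln (real n * real T + 2)"
  define M' where "M' = real (max 1 M)"
  define \<alpha> where "\<alpha> = 1 + log 2 (real CARD('x) + 1)"
  define B where "B = space_bound n T M R"
  let ?N = "real (T + 1) ^ (n + 2) * real (n + 1) * real (CARD('x) + 1) ^ n"
  have N1: "?N \<ge> 1" by (intro mult_ge1_I one_le_power) auto
  obtain s where s: "?N \<le> 2 ^ s" "real s \<le> log 2 ?N + 1" using bits_for_bound[OF N1] .
  obtain A :: "'x stream_alg" where A: "uses_space A s" "achieves_regret A n T M R"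
    using counting_alg[OF n feasible s(1)] .
  have RT: "R * T > 0" using R T by simp
  have nT: "real n \<le> real n * T" "real T \<le> real n * T"
    using mult_left_mono[of 1 "real T" "real n"] mult_right_mono[of 1 "real n" "real T"] n T by auto
  have B: "B \<ge> 1" "n * M' / (R * T) \<le> B" by (simp_all add: B_def space_bound_def M'_def)
  have \<alpha>: "\<alpha> \<ge> 1" by (simp add: \<alpha>_def)
  have l: "l \<ge> 1" using n by (simp add: l_def)
  have lL: "l \<le> 2 * L" unfolding l_def L_def using nT by (intro log2_le_twice_ln) auto
  have TL: "log 2 (real T + 1) \<le> 2 * L" unfolding L_def using nT by (intro log2_le_twice_ln) auto
  have "exp 1 \<le> real n * T + 2"
    using exp_le nT n by linarith
  then have L1: "L \<ge> 1" unfolding L_def by (subst ln_ge_iff) (auto intro: add_nonneg_pos)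
  have nL: "L \<le> n * L" "1 \<le> n * L" using n L1 mult_mono[of 1 "real n" 1 L] by auto
  have small': "R * T \<le> 8 * M' * l" using small by (simp add: M'_def l_def)
  have "real n * (R * T) \<le> real n * (8 * M' * l)" using small' by (intro mult_left_mono) auto
  then have "real n \<le> 8 * l * (n * M' / (R * T))" using RT by (simp add: le_divide_eq mult_ac)
  also have "\<dots> \<le> 8 * (2 * L) * B"
    using lL l B L1 RT by (intro mult_mono) (auto simp: M'_def)
  finally have nB: "n \<le> 16 * (L * B)" by simp
  have "log 2 ?N = real (n + 2) * log 2 (real T + 1) + l + n * (\<alpha> - 1)"
    by (simp add: log_mult log_nat_power l_def \<alpha>_def add.commute del: power_add power_Suc of_nat_add)
  also have "\<dots> \<le> (n + 2) * (2 * L) + 2 * L + n * (\<alpha> - 1)"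
    using TL lL by (intro add_mono mult_left_mono) auto
  \<comment> \<open>The terms \<open>(2 * n + 6) * L\<close> fit into \<open>8 * (n * L)\<close>;
    the spare 1 absorbs the rounding of the bit count.\<close>
  also have "\<dots> \<le> 8 * (n * L) + n * \<alpha> * L - 1"
  proof -
    have "n * \<alpha> * 1 \<le> n * \<alpha> * L" using \<alpha> L1 by (intro mult_left_mono) auto
    moreover have "real n \<ge> 1" using n by simp
    ultimately show ?thesis using nL by (simp add: algebra_simps)
  qed
  finally have "s \<le> 8 * (n * L) * 1 + n * \<alpha> * L" using s(2) by simp
  also have "\<dots> \<le> 8 * (n * L) * \<alpha> + n * \<alpha> * L"
    using \<alpha> nL by (intro add_right_mono mult_left_mono) auto
  also have "\<dots> \<le> 10 * \<alpha> * L * n" using \<alpha> L1 by simp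
  also have "\<dots> \<le> 10 * \<alpha> * L * (16 * (L * B))"
    using nB \<alpha> L1 by (intro mult_left_mono) auto
  finally have "s \<le> 160 * \<alpha> * L ^ 2 * B" by (simp add: power2_eq_square mult_ac)
  with A that show ?thesis by (simp add: L_def \<alpha>_def B_def add.commute)
qed

text \<open>Some condition on \<open>R\<close> is unavoidable: if two experts disagree on a single
  day, an adversary can make any prediction wrong and one expert right. Either \<open>R * T\<close>
  is above a threshold, or some algorithm with unrestricted memory achieves the regret.\<close>

theorem theorem4p1:
  "\<exists>(K::real) (C::real) (d::nat). \<forall>(n::nat) (T::nat) (M::nat) (R::real).
     n \<ge> 1 \<and> T \<ge> 1 \<and> R > 0 \<and>
     (R * real T \<ge> K * real (max 1 M) * ln (real n + 1) \<or>
      (\<exists>B :: ('x::finite) stream_alg. achieves_regret B n T M R)) \<longrightarrow>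
     (\<exists>(A :: 'x stream_alg) s. uses_space A s \<and>
        real s \<le> C * ln (real n * real T + 2) ^ d * space_bound n T M R \<and>
        achieves_regret A n T M R)"
proof (rule exI[of _ "8 / ln 2"], rule exI[of _ "160 * (1 + log 2 (CARD('x) + 1))"], rule exI[of _ 2],
    intro allI impI, elim conjE)
  fix n T M :: nat and R :: real
  assume n: "n \<ge> 1" and T: "T \<ge> 1" and R: "R > 0"
    and or: "R * real T \<ge> 8 / ln 2 * real (max 1 M) * ln (real n + 1) \<or>
      (\<exists>B :: 'x stream_alg. achieves_regret B n T M R)"
  \<comment> \<open>The factor \<open>8 / ln 2\<close> makes the threshold of the hypothesis that of
    the case split; below it, the second alternative must hold.\<close>
  have eq: "8 / ln 2 * real (max 1 M) * ln (real n + 1) = 8 * real (max 1 M) * log 2 (real n + 1)"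
    by (simp add: log_def)
  show "\<exists>(A :: 'x stream_alg) s. uses_space A s \<and>
      real s \<le> 160 * (1 + log 2 (CARD('x) + 1)) * ln (real n * real T + 2) ^ 2 * space_bound n T M R \<and>
      achieves_regret A n T M R"
  proof (cases "R * T \<ge> 8 * real (max 1 M) * log 2 (real n + 1)")
    case True
    then show ?thesis using halving_case[OF n T R, where ?'x = 'x] by metis
  next
    case False
    then obtain B :: "'x stream_alg" where "achieves_regret B n T M R"
      using or unfolding eq by blast
    with False show ?thesis using counting_case[OF n T R, of M B] by (metis not_le)
  qed
qed

end
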